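(* Let $p\in(1,\infty)$, $q\in(1,\infty)$, and let $\mathsf G=(\mathsf V,m,b,c)$ be a (possibly infinite) graph with $m(\mathsf V)<\infty$. (a) Suppose $\sup_{\mathsf v\in\mathsf V}c(\mathsf v)>0$ and there is $M>0$ with $\|u\|_{\ell^q(\mathsf V,m)}\le M\,Q_p^{\mathsf G}(u)^{1/p}$ for all $u\in w^{1,p,q}_{b,c}(\mathsf V,m)$. Then $\mathsf G$ is uniquely $q$-$p$-torsional-admissible, i.e. there is exactly one $u\in w^{1,p,q}_{b,c}(\mathsf V,m)$ such that $$\tfrac12\sum_{\mathsf v,\mathsf w\in\mathsf V}b(\mathsf v,\mathsf w)|u(\mathsf v)-u(\mathsf w)|^{p-2}(u(\mathsf v)-u(\mathsf w))(h(\mathsf v)-h(\mathsf w))+\sum_{\mathsf v\in\mathsf V}c(\mathsf v)|u(\mathsf v)|^{p-2}u(\mathsf v)h(\mathsf v)=\sum_{\mathsf v\in\mathsf V}h(\mathsf v)m(\mathsf v)$$ for all $h\in w^{1,p,q}_{b,c}(\mathsf V,m)\cap\ell^1(\mathsf V,m)$. Moreover, this $u$ (the $p$-torsion function) is the minimizer of $\mathfrak F_p^{\mathsf G}$ on $w^{1,p,q}_{b,c}(\mathsf V,m)$. (b) Suppose $\emptyset\ne\mathsf V_0\subset\mathsf V$ and there is $M>0$ with $\|u\|_{\ell^q(\mathsf V\setminus\mathsf V_0,m)}\le M\,Q_p^{\mathsf G}(u)^{1/p}$ for all $u\in\mathring w^{1,p,q}_{b,c;\mathsf V_0}(\mathsf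 V,m)$. Then $\mathsf G$ is uniquely $q$-$p$-torsional-admissible with Dirichlet conditions at $\mathsf V_0$, i.e. there is exactly one $u\in\mathring w^{1,p,q}_{b,c;\mathsf V_0}(\mathsf V,m)$ satisfying the same identity for all $h\in\mathring w^{1,p,q}_{b,c;\mathsf V_0}(\mathsf V,m)\cap\ell^1(\mathsf V,m)$. Moreover, this $u$ is the minimizer of $\mathfrak F_p^{\mathsf G}$ on $\mathring w^{1,p,q}_{b,c;\mathsf V_0}(\mathsf V,m)$.
   Context: A graph $\mathsf G=(\mathsf V,m,b,c)$ consists of a finite or countably infinite set $\mathsf V$, $m:\mathsf V\to(0,\infty)$, a symmetric $b:\mathsf V\times\mathsf V\to[0,\infty)$ with $b(\mathsf v,\mathsf v)=0$ and $\sum_{\mathsf w}b(\mathsf v,\mathsf w)<\infty$ for every $\mathsf v$, and $c:\mathsf V\to[0,\infty)$. $m(A)=\sum_{\mathsf v\in A}m(\mathsf v)$. Energy: $Q_p^{\mathsf G}(u)=\frac1{2p}\sum_{\mathsf v,\mathsf w}b(\mathsf v,\mathsf w)|u(\mathsf v)-u(\mathsf w)|^p+\frac1p\sum_{\mathsf v}c(\mathsf v)|u(\mathsf v)|^p$ for $u\in\mathbb R^{\mathsf V}$. Spaces: $w^{1,p,q}_{b,c}(\mathsf V,m)=\{u\in\ell^q(\mathsf V,m):Q_p^{\mathsf G}(u)<\infty\}$ and $\mathring w^{1,p,q}_{b,c;\mathsf V_0}(\mathsf V,m)=\{u\in w^{1,p,q}_{b,c}(\mathsf V,m):u=0\text{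 on }\mathsf V_0\}$, with norm $\|u\|_{\ell^q(\mathsf V,m)}+Q_p^{\mathsf G}(u)^{1/p}$. Here $\|u\|^q_{\ell^q(\mathsf V,m)}=\sum_{\mathsf v}|u(\mathsf v)|^qm(\mathsf v)$. Functional: $\mathfrak F_p^{\mathsf G}(u)=Q_p^{\mathsf G}(u)-\sum_{\mathsf v}u(\mathsf v)m(\mathsf v)$. Convention: $|x|^{p-2}x:=0$ for $x=0$. *)

theory Defs
  imports "HOL-Analysis.Analysis"
begin

text \<open>
  The vertex set is the universe of a type of class \<open>countable\<close>, i.e. an arbitrary nonempty finite
  or countably infinite set.
\<close>

locale weighted_graph =
  fixes m :: "'v::countable \<Rightarrow> real"
    and b :: "'v \<Rightarrow> 'v \<Rightarrow> real"
    and c :: "'v \<Rightarrow> real"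
  assumes m_pos: "m v > 0"
    and b_nonneg: "b v w \<ge> 0"
    and b_sym: "b v w = b w v"
    and b_diag: "b v v = 0"
    and b_summable: "b v summable_on UNIV"
    and c_nonneg: "c v \<ge> 0"

definition lq_space :: "real \<Rightarrow> ('v \<Rightarrow> real) \<Rightarrow> ('v \<Rightarrow> real) set" where
  "lq_space q m = {u. (\<lambda>v. \<bar>u v\<bar> powr q * m v) summable_on UNIV}"

definition lq_norm :: "real \<Rightarrow> 'v set \<Rightarrow> ('v \<Rightarrow> real) \<Rightarrow> ('v \<Rightarrow> real) \<Rightarrow> real" where
  "lq_norm q A m u = (\<Sum>\<^sub>\<infinity>v\<in>A. \<bar>u v\<bar> powr q * m v) powr (1 / q)"

definition energy ::
  "real \<Rightarrow> ('v \<Rightarrow> 'v \<Rightarrow> real) \<Rightarrow> ('v \<Rightarrow> real) \<Rightarrow> ('v \<Rightarrow> real) \<Rightarrow> ennreal" where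
  "energy p b c u =
     ennreal (1 / (2 * p)) * (\<Sum>\<^sub>\<infinity>(v, w)\<in>UNIV. ennreal (b v w * \<bar>u v - u w\<bar> powr p)) +
     ennreal (1 / p) * (\<Sum>\<^sub>\<infinity>v\<in>UNIV. ennreal (c v * \<bar>u v\<bar> powr p))"

definition w_space ::
  "real \<Rightarrow> real \<Rightarrow> ('v \<Rightarrow> real) \<Rightarrow> ('v \<Rightarrow> 'v \<Rightarrow> real) \<Rightarrow> ('v \<Rightarrow> real) \<Rightarrow> ('v \<Rightarrow> real) set" where
  "w_space p q m b c = {u \<in> lq_space q m. energy p b c u < \<infinity>}"

definition w0_space ::
  "real \<Rightarrow> real \<Rightarrow> ('v \<Rightarrow> real) \<Rightarrow> ('v \<Rightarrow> 'v \<Rightarrow> real) \<Rightarrow> ('v \<Rightarrow> real) \<Rightarrow> 'v set \<Rightarrow> ('v \<Rightarrow> real) set" where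
  "w0_space p q m b c V0 = {u \<in> w_space p q m b c. \<forall>v\<in>V0. u v = 0}"

text \<open>
  Only meaningful for \<open>u\<close> of finite energy and in \<open>\<ell>\<^sup>1\<close>; on the spaces above both hold
  as soon as \<open>m\<close> is summable and \<open>q \<ge> 1\<close>.
\<close>
definition torsion_functional ::
  "real \<Rightarrow> ('v \<Rightarrow> real) \<Rightarrow> ('v \<Rightarrow> 'v \<Rightarrow> real) \<Rightarrow> ('v \<Rightarrow> real) \<Rightarrow> ('v \<Rightarrow> real) \<Rightarrow> real" where
  "torsion_functional p m b c u = enn2real (energy p b c u) - (\<Sum>\<^sub>\<infinity>v. u v * m v)"

text \<open>
  Since \<open>0 powr x = 0\<close>, the expression \<open>\<bar>x\<bar> powr (p - 2) * x\<close> vanishes at \<open>x = 0\<close>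
  also for \<open>p < 2\<close>. For \<open>u\<close> and \<open>h\<close> of finite energy both sums converge absolutely
  by Hoelder's inequality.
\<close>
definition energy_deriv ::
  "real \<Rightarrow> ('v \<Rightarrow> 'v \<Rightarrow> real) \<Rightarrow> ('v \<Rightarrow> real) \<Rightarrow> ('v \<Rightarrow> real) \<Rightarrow> ('v \<Rightarrow> real) \<Rightarrow> real" where
  "energy_deriv p b c u h =
     1 / 2 * (\<Sum>\<^sub>\<infinity>(v, w)\<in>UNIV. b v w * (\<bar>u v - u w\<bar> powr (p - 2) * (u v - u w)) * (h v - h w)) +
     (\<Sum>\<^sub>\<infinity>v. c v * (\<bar>u v\<bar> powr (p - 2) * u v) * h v)"

text \<open>The space \<open>W\<close> is \<open>w_space p q m b c\<close> or \<open>w0_space p q m b c V0\<close>.\<close>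
definition torsion_function ::
  "real \<Rightarrow> ('v \<Rightarrow> real) \<Rightarrow> ('v \<Rightarrow> 'v \<Rightarrow> real) \<Rightarrow> ('v \<Rightarrow> real) \<Rightarrow> ('v \<Rightarrow> real) set \<Rightarrow> ('v \<Rightarrow> real) \<Rightarrow> bool" where
  "torsion_function p m b c W u \<longleftrightarrow>
     u \<in> W \<and> (\<forall>h \<in> W \<inter> lq_space 1 m. energy_deriv p b c u h = (\<Sum>\<^sub>\<infinity>v. h v * m v))"

definition uniquely_torsional_admissible ::
  "real \<Rightarrow> real \<Rightarrow> ('v \<Rightarrow> real) \<Rightarrow> ('v \<Rightarrow> 'v \<Rightarrow> real) \<Rightarrow> ('v \<Rightarrow> real) \<Rightarrow> bool" where
  "uniquely_torsional_admissible q p m b c \<longleftrightarrow>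
     (\<exists>!u. torsion_function p m b c (w_space p q m b c) u)"

definition uniquely_torsional_admissible_Dirichlet ::
  "real \<Rightarrow> real \<Rightarrow> ('v \<Rightarrow> real) \<Rightarrow> ('v \<Rightarrow> 'v \<Rightarrow> real) \<Rightarrow> ('v \<Rightarrow> real) \<Rightarrow> 'v set \<Rightarrow> bool" where
  "uniquely_torsional_admissible_Dirichlet q p m b c V0 \<longleftrightarrow>
     (\<exists>!u. torsion_function p m b c (w0_space p q m b c V0) u)"

end

theory Submission
  imports Defs "HOL-Complex_Analysis.Great_Picard"
begin

text \<open>
  Torsion functions are the minimizers of the strictly convex functional \<open>\<FF>\<close>. By the Poincare type
  inequality and \<open>m(V) < \<infinity>\<close> the linear part is bounded by a multiple of \<open>(Q + 1)\<^bsup>1/p\<^esup>\<close>, so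
  \<open>\<FF>\<close> is coercive and a minimizing sequence is bounded in \<open>\<ell>\<^sup>q\<close>, hence has a pointwise convergent
  subsequence. Fatou's lemma makes the energy lower semicontinuous along it; since \<open>q > 1\<close> the linear
  part does not lose mass, because \<open>\<bar>x\<bar> \<le> R + R\<^bsup>1-q\<^esup> \<bar>x\<bar>\<^sup>q\<close> with \<open>R \<rightarrow> \<infinity>\<close>, and the limit
  is a minimizer. The tangent inequality for \<open>\<bar>x\<bar>\<^sup>p\<close> identifies minimizers with weak solutions, and
  strict monotonicity of \<open>\<bar>x\<bar>\<^bsup>p-2\<^esup>x\<close> together with the Poincare type inequality gives uniqueness.
\<close>

section \<open>Infinite sums: Fatou's lemma, sums in \<open>ennreal\<close>, sums over a disjoint
  union\<close>

text \<open>Finite partial sums pass to the limit term by term and stay below \<open>C\<close>, and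
  nonnegative terms are summable as soon as their finite sums are bounded. A convergent bound
  \<open>B\<close> stands in for the liminf of the sums.\<close>

lemma infsum_Fatou:
  fixes f :: "nat \<Rightarrow> 'a \<Rightarrow> real"
  assumes nonneg: "\<And>n x. f n x \<ge> 0"
    and summ: "\<And>n. f n summable_on UNIV"
    and le: "\<And>n. infsum (f n) UNIV \<le> B n"
    and B: "B \<longlonglongrightarrow> C"
    and lim: "\<And>x. (\<lambda>n. f n x) \<longlonglongrightarrow> g x"
  shows "g summable_on UNIV" and "infsum g UNIV \<le> C"
proof -
  have g0: "g x \<ge> 0" for x
    using LIMSEQ_le_const[OF lim] nonneg by blast
  have fin: "sum g K \<le> C" if "finite K" for K
  proof (rule LIMSEQ_le[OF _ B])
    show "(\<lambda>n. sum (f n) K) \<longlonglongrightarrow> sum g K"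
      by (intro tendsto_sum lim)
    have "sum (f n) K \<le> B n" for n
      using finite_sum_le_infsum[OF summ that] nonneg le[of n] by (meson UNIV_I order_trans subset_UNIV)
    then show "\<exists>N. \<forall>n\<ge>N. sum (f n) K \<le> B n" by blast
  qed
  show "g summable_on UNIV"
    by (rule nonneg_bdd_above_summable_on) (auto simp: g0 intro!: bdd_aboveI2[where M = C] fin)
  then show "infsum g UNIV \<le> C"
    by (rule infsum_le_finite_sums) (rule fin)
qed

text \<open>Links the \<open>ennreal\<close>-valued \<open>energy\<close> with real sums.
  \<open>ennreal\<close> is continuous, and additive on nonnegative reals; conversely a finite value
  bounds every finite partial sum.\<close>

lemma infsum_ennreal_of_nonneg:
  fixes f :: "'a \<Rightarrow> real"
  assumes "\<And>x. f x \<ge> 0"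
  shows "f summable_on UNIV \<Longrightarrow> (\<Sum>\<^sub>\<infinity>x. ennreal (f x)) = ennreal (infsum f UNIV)"
    and "(\<Sum>\<^sub>\<infinity>x. ennreal (f x)) < \<infinity> \<longleftrightarrow> f summable_on UNIV"
proof -
  show eq: "(\<Sum>\<^sub>\<infinity>x. ennreal (f x)) = ennreal (infsum f UNIV)" if "f summable_on UNIV"
  proof -
    have "infsum (ennreal \<circ> f) UNIV = ennreal (infsum f UNIV)"
    proof (rule infsum_comm_additive_general[OF _ _ that])
      show "isCont ennreal (infsum f UNIV)"
        by (simp add: isCont_def tendsto_ennrealI)
    qed (auto simp: assms)
    then show ?thesis by (simp add: o_def)
  qed
  show "(\<Sum>\<^sub>\<infinity>x. ennreal (f x)) < \<infinity> \<longleftrightarrow> f summable_on UNIV"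
  proof
    assume fin: "(\<Sum>\<^sub>\<infinity>x. ennreal (f x)) < \<infinity>"
    show "f summable_on UNIV"
    proof (rule nonneg_bdd_above_summable_on)
      have "sum f K \<le> enn2real (\<Sum>\<^sub>\<infinity>x. ennreal (f x))" if "finite K" for K
      proof -
        have "ennreal (sum f K) = sum (\<lambda>x. ennreal (f x)) K"
          by (simp add: assms)
        also have "\<dots> \<le> (\<Sum>\<^sub>\<infinity>x. ennreal (f x))"
          unfolding infsum_finite[OF that, symmetric] by (rule infsum_mono_neutral) (auto intro: nonneg_summable_on_complete)
        finally show ?thesis
          using fin by (metis assms enn2real_ennreal enn2real_mono infinity_ennreal_def sum_nonneg)
      qed
      then show "bdd_above (sum f ` {F. F \<subseteq> UNIV \<and> finite F})"
        by (intro bdd_aboveI2) auto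
    qed (rule assms)
  qed (simp add: eq)
qed

lemma has_sum_sum_type:
  fixes f :: "'a + 'b \<Rightarrow> 'c::topological_comm_monoid_add"
  assumes "((\<lambda>x. f (Inl x)) has_sum s) UNIV" and "((\<lambda>y. f (Inr y)) has_sum t) UNIV"
  shows "(f has_sum (s + t)) UNIV"
proof -
  have "(f has_sum s) (range Inl)" "(f has_sum t) (range Inr)"
    using assms by (auto simp: has_sum_reindex o_def)
  then have "(f has_sum (s + t)) (range Inl \<union> range Inr)"
    by (rule has_sum_Un_disjoint) auto
  also have "range Inl \<union> range Inr = (UNIV :: ('a + 'b) set)"
    by (auto simp: UNIV_sum)
  finally show ?thesis .
qed

lemma summable_on_sum_type:
  fixes f :: "'a + 'b \<Rightarrow> real"
  shows "f summable_on UNIV \<longleftrightarrow>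
    (\<lambda>x. f (Inl x)) summable_on UNIV \<and> (\<lambda>y. f (Inr y)) summable_on UNIV"
proof
  assume f: "f summable_on UNIV"
  have "f summable_on range Inl" "f summable_on range Inr"
    using f by (auto intro: summable_on_subset_banach)
  then show "(\<lambda>x. f (Inl x)) summable_on UNIV \<and> (\<lambda>y. f (Inr y)) summable_on UNIV"
    by (auto simp: summable_on_reindex o_def)
qed (auto simp: summable_on_def dest: has_sum_sum_type)

lemma infsum_sum_type:
  fixes f :: "'a + 'b \<Rightarrow> real"
  assumes "f summable_on UNIV"
  shows "infsum f UNIV = (\<Sum>\<^sub>\<infinity>x. f (Inl x)) + (\<Sum>\<^sub>\<infinity>y. f (Inr y))"
  using assms by (intro infsumI has_sum_sum_type has_sum_infsum) (simp_all add: summable_on_sum_type)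

section \<open>Pointwise inequalities for \<open>\<bar>x\<bar> powr p\<close> and its
  derivative\<close>

lemma abs_add_powr_le:
  fixes x y p :: real
  assumes "p \<ge> 0"
  shows "\<bar>x + y\<bar> powr p \<le> 2 powr p * (\<bar>x\<bar> powr p + \<bar>y\<bar> powr p)"
proof -
  have "\<bar>x + y\<bar> powr p \<le> (2 * max \<bar>x\<bar> \<bar>y\<bar>) powr p"
    by (rule powr_mono2) (use assms in auto)
  also have "\<dots> = 2 powr p * max \<bar>x\<bar> \<bar>y\<bar> powr p"
    by (simp add: powr_mult)
  also have "\<dots> \<le> 2 powr p * (\<bar>x\<bar> powr p + \<bar>y\<bar> powr p)"
    by (intro mult_left_mono) (auto simp: max_def)
  finally show ?thesis .
qed

text \<open>Rewrites the derivative of \<open>\<bar>x\<bar> powr p / p\<close> without the exponent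
  \<open>p - 2\<close>, which is negative for \<open>p < 2\<close>. At \<open>x = 0\<close> the
  identities rest on \<open>0 powr s = 0\<close>.\<close>

lemma abs_powr_minus_2_mult:
  fixes x p :: real
  shows "\<bar>x\<bar> powr (p - 2) * x = sgn x * \<bar>x\<bar> powr (p - 1)"
    and "\<bar>x\<bar> powr (p - 2) * x * x = \<bar>x\<bar> powr p"
    and "\<bar>\<bar>x\<bar> powr (p - 2) * x\<bar> = \<bar>x\<bar> powr (p - 1)"
proof -
  have "\<bar>x\<bar> powr (p - 1) = \<bar>x\<bar> powr (p - 2) * \<bar>x\<bar>"
    using powr_add[of "\<bar>x\<bar>" "p - 2" 1] by (cases "x = 0") simp_all
  then show 1: "\<bar>x\<bar> powr (p - 2) * x = sgn x * \<bar>x\<bar> powr (p - 1)"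
    by (simp add: sgn_mult_abs mult.left_commute)
  show "\<bar>\<bar>x\<bar> powr (p - 2) * x\<bar> = \<bar>x\<bar> powr (p - 1)"
    unfolding 1 by (simp add: abs_mult sgn_if)
  have "\<bar>x\<bar> powr p = \<bar>x\<bar> powr (p - 1) * \<bar>x\<bar>"
    using powr_add[of "\<bar>x\<bar>" "p - 1" 1] by (cases "x = 0") simp_all
  then show "\<bar>x\<bar> powr (p - 2) * x * x = \<bar>x\<bar> powr p"
    unfolding 1 by (simp add: sgn_if)
qed

text \<open>This is Young's inequality for \<open>\<bar>y\<bar>\<close> and
  \<open>\<bar>x\<bar> powr (p - 1)\<close>: the conjugate exponent \<open>q = p / (p - 1)\<close>
  turns the latter back into \<open>\<bar>x\<bar> powr p\<close>.\<close>

lemma abs_powr_tangent_le: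
  fixes x y p :: real
  assumes "p > 1"
  shows "\<bar>x\<bar> powr p / p + \<bar>x\<bar> powr (p - 2) * x * (y - x) \<le> \<bar>y\<bar> powr p / p"
proof -
  define q where "q = p / (p - 1)"
  have "\<bar>x\<bar> powr (p - 2) * x * y \<le> \<bar>\<bar>x\<bar> powr (p - 2) * x * y\<bar>" by simp
  also have "\<dots> = \<bar>y\<bar> * \<bar>x\<bar> powr (p - 1)"
    by (subst abs_mult) (simp only: abs_powr_minus_2_mult(3) mult.commute[of _ "\<bar>y\<bar>"])
  also have "\<dots> \<le> \<bar>y\<bar> powr p / p + (\<bar>x\<bar> powr (p - 1)) powr q / q"
    by (rule Youngs_inequality) (use assms in \<open>auto simp: q_def field_simps\<close>)
  also have "(\<bar>x\<bar> powr (p - 1)) powr q = \<bar>x\<bar> powr p"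
    using assms by (simp add: q_def powr_powr)
  also have "\<bar>x\<bar> powr p / q = \<bar>x\<bar> powr p - \<bar>x\<bar> powr p / p"
    using assms by (simp add: q_def field_simps)
  finally show ?thesis
    using abs_powr_minus_2_mult(2)[of x p] by (simp add: right_diff_distrib)
qed

text \<open>In the form \<open>sgn x * \<bar>x\<bar> powr (p - 1)\<close> the claim reduces to
  monotonicity of \<open>powr\<close> on nonnegative bases, hence the split by signs.\<close>

lemma abs_powr_deriv_strict_mono:
  fixes x y p :: real
  assumes "p > 1" and "x < y"
  shows "\<bar>x\<bar> powr (p - 2) * x < \<bar>y\<bar> powr (p - 2) * y"
proof -
  consider "0 \<le> x" | "x < 0" "0 < y" | "x < 0" "y = 0" | "y < 0" using assms by linarith
  then show ?thesis
  proof cases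
    case 1
    have "x powr (p - 1) < y powr (p - 1)"
      by (rule powr_less_mono2) (use assms 1 in auto)
    then show ?thesis using 1 assms unfolding abs_powr_minus_2_mult(1) by (simp add: sgn_if)
  next
    case 2
    have "(- x) powr (p - 1) > 0" "y powr (p - 1) > 0" using 2 by simp_all
    then show ?thesis using 2 unfolding abs_powr_minus_2_mult(1)
      by (auto intro: order.strict_trans[of _ 0])
  next
    case 3
    then show ?thesis unfolding abs_powr_minus_2_mult(1) by simp
  next
    case 4
    have "(- y) powr (p - 1) < (- x) powr (p - 1)"
      by (rule powr_less_mono2) (use assms 4 in auto)
    then show ?thesis using 4 assms unfolding abs_powr_minus_2_mult(1) by simp
  qed
qed

lemma abs_powr_deriv_monotone:
  fixes x y p :: real
  assumes "p > 1"
  shows "0 \<le> (\<bar>x\<bar> powr (p - 2) * x - \<bar>y\<bar> powr (p - 2) * y) * (x - y)"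
    and "(\<bar>x\<bar> powr (p - 2) * x - \<bar>y\<bar> powr (p - 2) * y) * (x - y) = 0 \<Longrightarrow> x = y"
proof -
  have "(\<bar>x\<bar> powr (p - 2) * x - \<bar>y\<bar> powr (p - 2) * y) * (x - y) > 0" if "x \<noteq> y"
  proof (cases "x < y")
    case True
    then show ?thesis
      using abs_powr_deriv_strict_mono[OF assms True] by (intro mult_neg_neg) simp_all
  next
    case False
    then have "y < x" using that by simp
    then show ?thesis
      using abs_powr_deriv_strict_mono[OF assms \<open>y < x\<close>] by (intro mult_pos_pos) simp_all
  qed
  then show "0 \<le> (\<bar>x\<bar> powr (p - 2) * x - \<bar>y\<bar> powr (p - 2) * y) * (x - y)"
    and "(\<bar>x\<bar> powr (p - 2) * x - \<bar>y\<bar> powr (p - 2) * y) * (x - y) = 0 \<Longrightarrow> x = y"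
    by (cases "x = y"; force)+
qed

text \<open>Only \<open>x = 0\<close> is delicate, since \<open>\<bar>x\<bar> powr (p - 2)\<close>
  blows up there for \<open>p < 2\<close>; the absolute value
  \<open>\<bar>x\<bar> powr (p - 1)\<close> still tends to 0.\<close>

lemma tendsto_abs_powr_deriv:
  fixes p :: real and f :: "nat \<Rightarrow> real"
  assumes "p > 1" and f: "f \<longlonglongrightarrow> x"
  shows "(\<lambda>n. \<bar>f n\<bar> powr (p - 2) * f n) \<longlonglongrightarrow> \<bar>x\<bar> powr (p - 2) * x"
proof (cases "x = 0")
  case True
  have "(\<lambda>n. \<bar>f n\<bar> powr (p - 1)) \<longlonglongrightarrow> \<bar>x\<bar> powr (p - 1)"
    by (rule tendsto_powr2) (use assms in \<open>auto intro!: tendsto_intros\<close>)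
  then have "(\<lambda>n. \<bar>\<bar>f n\<bar> powr (p - 2) * f n\<bar>) \<longlonglongrightarrow> 0"
    unfolding abs_powr_minus_2_mult(3) using True by simp
  then show ?thesis
    using True by (simp add: tendsto_rabs_zero_iff)
qed (auto intro!: tendsto_intros f)

text \<open>Replacing both arguments by the larger absolute value suffices. This makes the
  derivative sum converge absolutely and supplies its majorant.\<close>

lemma abs_powr_deriv_mult_le:
  fixes x y p :: real
  assumes "p > 1"
  shows "\<bar>\<bar>x\<bar> powr (p - 2) * x * y\<bar> \<le> \<bar>x\<bar> powr p + \<bar>y\<bar> powr p"
proof -
  define z where "z = max \<bar>x\<bar> \<bar>y\<bar>"
  have "\<bar>\<bar>x\<bar> powr (p - 2) * x * y\<bar> = \<bar>x\<bar> powr (p - 1) * \<bar>y\<bar>"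
    by (subst abs_mult) (simp only: abs_powr_minus_2_mult(3))
  also have "\<dots> \<le> z powr (p - 1) * z"
    by (intro mult_mono powr_mono2) (use assms in \<open>auto simp: z_def\<close>)
  also have "\<dots> = z powr p"
    using powr_add[of z "p - 1" 1] by (cases "z = 0") (simp_all add: z_def)
  also have "\<dots> \<le> \<bar>x\<bar> powr p + \<bar>y\<bar> powr p"
    by (simp add: z_def max_def)
  finally show ?thesis .
qed

text \<open>Replaces Hoelder's inequality: it interpolates \<open>\<ell>\<^sup>1\<close> between \<open>\<ell>\<^sup>\<infinity>\<close> and \<open>\<ell>\<^sup>q\<close>.\<close>
lemma abs_le_truncation:
  fixes x q R :: real
  assumes "q \<ge> 1" and "R > 0"
  shows "\<bar>x\<bar> \<le> R + R powr (1 - q) * \<bar>x\<bar> powr q"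
proof (cases "\<bar>x\<bar> \<le> R")
  case False
  then have x: "\<bar>x\<bar> > 0" using assms by linarith
  have "1 \<le> (\<bar>x\<bar> / R) powr (q - 1)"
    by (rule ge_one_powr_ge_zero) (use False assms in \<open>auto simp: field_simps\<close>)
  then have "\<bar>x\<bar> \<le> (\<bar>x\<bar> / R) powr (q - 1) * \<bar>x\<bar>"
    using x by simp
  also have "(\<bar>x\<bar> / R) powr (q - 1) * \<bar>x\<bar> = R powr (1 - q) * \<bar>x\<bar> powr q"
    using x assms powr_add[of "\<bar>x\<bar>" "q - 1" 1] powr_minus_divide[of R "q - 1"]
    by (simp add: powr_divide field_simps)
  finally show ?thesis using assms by simp
qed (use assms in \<open>simp add: add_increasing2\<close>)

section \<open>The abstract variational problem for a weighted p-norm of a linear map\<close>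

text \<open>\<open>L\<close> stands for edge differences and vertex values together; only linearity
  and continuity under pointwise limits of sequences are asked of it. \<open>V0\<close> may be
  empty, so both kinds of boundary condition are covered.\<close>

locale torsion_problem =
  fixes p q :: real
    and m :: "'v::countable \<Rightarrow> real"
    and a :: "'i \<Rightarrow> real"
    and L :: "('v \<Rightarrow> real) \<Rightarrow> 'i \<Rightarrow> real"
    and V0 :: "'v set"
  assumes p: "p > 1" and q: "q > 1"
    and m_pos: "m v > 0"
    and m_summable: "m summable_on UNIV"
    and a_nonneg: "a i \<ge> 0"
    and L_linear: "L (\<lambda>v. u v + t * h v) i = L u i + t * L h i"
    and L_tendsto: "(\<And>v. (\<lambda>n. U n v) \<longlonglongrightarrow> u v) \<Longrightarrow> (\<lambda>n. L (U n) i) \<longlonglongrightarrow> L u i"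
begin

definition W :: "('v \<Rightarrow> real) set" where
  "W = {u. (\<lambda>v. \<bar>u v\<bar> powr q * m v) summable_on UNIV \<and>
           (\<lambda>i. a i * \<bar>L u i\<bar> powr p) summable_on UNIV \<and> (\<forall>v\<in>V0. u v = 0)}"

text \<open>Without the prefactor \<open>1 / p\<close>, this is \<open>p\<close> times the energy.
  Accordingly \<open>D u h\<close> below is the directional derivative of \<open>E / p\<close>, and
  \<open>N\<close> is the q-th power of the norm.\<close>

definition E :: "('v \<Rightarrow> real) \<Rightarrow> real" where
  "E u = (\<Sum>\<^sub>\<infinity>i. a i * \<bar>L u i\<bar> powr p)"

definition D :: "('v \<Rightarrow> real) \<Rightarrow> ('v \<Rightarrow> real) \<Rightarrow> real" where
  "D u h = (\<Sum>\<^sub>\<infinity>i. a i * (\<bar>L u i\<bar> powr (p - 2) * L u i) * L h i)"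

definition N :: "('v \<Rightarrow> real) \<Rightarrow> real" where
  "N u = (\<Sum>\<^sub>\<infinity>v. \<bar>u v\<bar> powr q * m v)"

definition l :: "('v \<Rightarrow> real) \<Rightarrow> real" where
  "l u = (\<Sum>\<^sub>\<infinity>v. u v * m v)"

definition F :: "('v \<Rightarrow> real) \<Rightarrow> real" where
  "F u = E u / p - l u"

lemma N_summable: "u \<in> W \<Longrightarrow> (\<lambda>v. \<bar>u v\<bar> powr q * m v) summable_on UNIV"
  by (simp add: W_def)

lemma E_summable: "u \<in> W \<Longrightarrow> (\<lambda>i. a i * \<bar>L u i\<bar> powr p) summable_on UNIV"
  by (simp add: W_def)

lemma E_nonneg: "E u \<ge> 0"
  unfolding E_def by (intro infsum_nonneg) (simp add: a_nonneg)

lemma N_nonneg: "N u \<ge> 0"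
  unfolding N_def by (intro infsum_nonneg) (simp add: m_pos less_imp_le)

lemma L_zero: "L (\<lambda>v. 0) i = 0"
  using L_linear[of "\<lambda>v. 0" 1 "\<lambda>v. 0" i] by simp

lemma L_diff: "L (\<lambda>v. u v - h v) i = L u i - L h i"
  using L_linear[of u "-1" h i] by simp

lemma zero_in_W: "(\<lambda>v. 0) \<in> W"
  by (simp add: W_def L_zero)

text \<open>Integrates the right-hand side of \<open>abs_le_truncation\<close>; the constant is
  summable because the total mass is finite.\<close>

lemma truncation_summable:
  assumes "u \<in> W"
  shows "(\<lambda>v. (R + r * \<bar>u v\<bar> powr q) * m v) summable_on UNIV"
    and "(\<Sum>\<^sub>\<infinity>v. (R + r * \<bar>u v\<bar> powr q) * m v) = R * infsum m UNIV + r * N u"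
proof -
  have eq: "(\<lambda>v. (R + r * \<bar>u v\<bar> powr q) * m v) = (\<lambda>v. R * m v + r * (\<bar>u v\<bar> powr q * m v))"
    by (simp add: algebra_simps)
  note s = summable_on_cmult_right[OF m_summable, of R]
    summable_on_cmult_right[OF N_summable[OF assms], of r]
  show "(\<lambda>v. (R + r * \<bar>u v\<bar> powr q) * m v) summable_on UNIV"
    unfolding eq by (intro summable_on_add s)
  show "(\<Sum>\<^sub>\<infinity>v. (R + r * \<bar>u v\<bar> powr q) * m v) = R * infsum m UNIV + r * N u"
    unfolding eq N_def infsum_add[OF s] by (simp add: infsum_cmult_right')
qed

text \<open>On a space of finite mass, q-summability implies summability: truncate at level
  \<open>R = 1\<close>.\<close>

lemma abs_summable_W:
  assumes "u \<in> W"
  shows "(\<lambda>v. \<bar>u v\<bar> * m v) summable_on UNIV"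
proof (rule summable_on_comparison_test)
  show "(\<lambda>v. (1 + 1 powr (1 - q) * \<bar>u v\<bar> powr q) * m v) summable_on UNIV"
    by (rule truncation_summable[OF assms])
  show "\<bar>u v\<bar> * m v \<le> (1 + 1 powr (1 - q) * \<bar>u v\<bar> powr q) * m v" for v
    using q by (intro mult_right_mono abs_le_truncation) (auto simp: m_pos less_imp_le)
qed (simp add: m_pos less_imp_le)

lemma l_summable:
  assumes "u \<in> W"
  shows "(\<lambda>v. u v * m v) summable_on UNIV"
  by (rule abs_summable_summable) (use abs_summable_W[OF assms] in \<open>simp add: abs_mult abs_of_pos[OF m_pos]\<close>)

lemma l_add_scaled:
  assumes "u \<in> W" and "h \<in> W"
  shows "l (\<lambda>v. u v + t * h v) = l u + t * l h"
proof -
  have "(\<lambda>v. (u v + t * h v) * m v) = (\<lambda>v. u v * m v + t * (h v * m v))"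
    by (simp add: algebra_simps)
  then show ?thesis
    unfolding l_def
    by (simp add: infsum_add[OF l_summable[OF assms(1)] summable_on_cmult_right[OF l_summable[OF assms(2)]]]
        infsum_cmult_right')
qed

lemma W_add_scaled:
  assumes "u \<in> W" and "h \<in> W"
  shows "(\<lambda>v. u v + t * h v) \<in> W"
proof -
  have "(\<lambda>v. \<bar>u v + t * h v\<bar> powr q * m v) summable_on UNIV"
  proof (rule summable_on_comparison_test)
    show "(\<lambda>v. 2 powr q * (\<bar>u v\<bar> powr q * m v) + 2 powr q * \<bar>t\<bar> powr q * (\<bar>h v\<bar> powr q * m v)) summable_on UNIV"
      by (intro summable_on_add summable_on_cmult_right N_summable assms)
    fix v
    show "\<bar>u v + t * h v\<bar> powr q * m v \<le>
        2 powr q * (\<bar>u v\<bar> powr q * m v) + 2 powr q * \<bar>t\<bar> powr q * (\<bar>h v\<bar> powr q * m v)"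
      using mult_right_mono[OF abs_add_powr_le[of q "u v" "t * h v"], of "m v"] q m_pos[of v]
      by (simp add: abs_mult powr_mult algebra_simps)
  qed (simp add: m_pos less_imp_le)
  moreover have "(\<lambda>i. a i * \<bar>L (\<lambda>v. u v + t * h v) i\<bar> powr p) summable_on UNIV"
  proof (rule summable_on_comparison_test)
    show "(\<lambda>i. 2 powr p * (a i * \<bar>L u i\<bar> powr p) + 2 powr p * \<bar>t\<bar> powr p * (a i * \<bar>L h i\<bar> powr p)) summable_on UNIV"
      by (intro summable_on_add summable_on_cmult_right E_summable assms)
    fix i
    show "a i * \<bar>L (\<lambda>v. u v + t * h v) i\<bar> powr p \<le>
        2 powr p * (a i * \<bar>L u i\<bar> powr p) + 2 powr p * \<bar>t\<bar> powr p * (a i * \<bar>L h i\<bar> powr p)"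
      unfolding L_linear
      using mult_left_mono[OF abs_add_powr_le[of p "L u i" "t * L h i"] a_nonneg[of i]] p
      by (simp add: abs_mult powr_mult algebra_simps)
  qed (simp add: a_nonneg)
  ultimately show ?thesis
    using assms by (simp add: W_def)
qed

lemma W_diff: "u \<in> W \<Longrightarrow> h \<in> W \<Longrightarrow> (\<lambda>v. u v - h v) \<in> W"
  using W_add_scaled[of u h "-1"] by simp

lemma l_diff: "u \<in> W \<Longrightarrow> h \<in> W \<Longrightarrow> l (\<lambda>v. u v - h v) = l u - l h"
  using l_add_scaled[of u h "-1"] by simp

lemma D_summable:
  assumes "u \<in> W" and "h \<in> W"
  shows "(\<lambda>i. a i * (\<bar>L u i\<bar> powr (p - 2) * L u i) * L h i) summable_on UNIV"
proof (rule abs_summable_summable, rule summable_on_comparison_test)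
  show "(\<lambda>i. a i * \<bar>L u i\<bar> powr p + a i * \<bar>L h i\<bar> powr p) summable_on UNIV"
    by (intro summable_on_add E_summable assms)
  fix i
  have "a i * \<bar>\<bar>L u i\<bar> powr (p - 2) * L u i * L h i\<bar> \<le> a i * (\<bar>L u i\<bar> powr p + \<bar>L h i\<bar> powr p)"
    by (intro mult_left_mono a_nonneg abs_powr_deriv_mult_le p)
  then show "norm (a i * (\<bar>L u i\<bar> powr (p - 2) * L u i) * L h i) \<le> a i * \<bar>L u i\<bar> powr p + a i * \<bar>L h i\<bar> powr p"
    using a_nonneg[of i] by (simp add: abs_mult algebra_simps)
qed simp

text \<open>Convexity of \<open>E / p\<close>, obtained by weighting the scalar tangent inequality
  with \<open>a i\<close> and summing.\<close>

lemma E_tangent_le: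
  assumes "u \<in> W" and "h \<in> W"
  shows "E u / p + D u (\<lambda>v. h v - u v) \<le> E h / p"
proof -
  note su = summable_on_cmult_right[OF E_summable[OF assms(1)], of "1 / p"]
    and sh = summable_on_cmult_right[OF E_summable[OF assms(2)], of "1 / p"]
    and sd = D_summable[OF assms(1) W_diff[OF assms(2,1)]]
  have "E u / p + D u (\<lambda>v. h v - u v) =
    (\<Sum>\<^sub>\<infinity>i. 1 / p * (a i * \<bar>L u i\<bar> powr p)
          + a i * (\<bar>L u i\<bar> powr (p - 2) * L u i) * L (\<lambda>v. h v - u v) i)"
    unfolding infsum_add[OF su sd] infsum_cmult_right' E_def D_def by simp
  also have "\<dots> \<le> (\<Sum>\<^sub>\<infinity>i. 1 / p * (a i * \<bar>L h i\<bar> powr p))"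
  proof (rule infsum_mono[OF summable_on_add[OF su sd] sh])
    fix i
    show "1 / p * (a i * \<bar>L u i\<bar> powr p) + a i * (\<bar>L u i\<bar> powr (p - 2) * L u i) * L (\<lambda>v. h v - u v) i
        \<le> 1 / p * (a i * \<bar>L h i\<bar> powr p)"
      using mult_left_mono[OF abs_powr_tangent_le[OF p, of "L u i" "L h i"] a_nonneg[of i]]
      by (simp add: L_diff algebra_simps)
  qed
  also have "\<dots> = E h / p"
    unfolding infsum_cmult_right' E_def by simp
  finally show ?thesis .
qed

lemma D_minus: "D u (\<lambda>v. - h v) = - D u h"
  using L_linear[of "\<lambda>v. 0" "-1" h] by (simp add: D_def L_zero infsum_uminus)

section \<open>Equivalence of the weak equation and minimality\<close>

definition critical :: "('v \<Rightarrow> real) \<Rightarrow> bool" where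
  "critical u \<longleftrightarrow> u \<in> W \<and> (\<forall>h\<in>W. D u h = l h)"

text \<open>Testing the weak equation with \<open>h - u\<close> turns the tangent term at
  \<open>u\<close> into \<open>l h - l u\<close>.\<close>

lemma critical_imp_minimal:
  assumes "critical u" and "h \<in> W"
  shows "F u \<le> F h"
proof -
  have u: "u \<in> W" using assms by (simp add: critical_def)
  have "D u (\<lambda>v. h v - u v) = l h - l u"
    using assms W_diff[OF assms(2) u] l_diff[OF assms(2) u] by (simp add: critical_def)
  then show ?thesis
    using E_tangent_le[OF u assms(2)] by (simp add: F_def)
qed

text \<open>The convexity inequality based at \<open>u + t h\<close> gives \<open>D (u + t h) h \<ge> l h\<close> for \<open>t > 0\<close>.
  Fatou's lemma, applied to an integrable majorant minus the integrand of \<open>D (u + t h) h\<close>, lets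
  \<open>t\<close> tend to 0.\<close>
lemma minimal_imp_D_ge:
  assumes u: "u \<in> W" and min: "\<And>g. g \<in> W \<Longrightarrow> F u \<le> F g" and h: "h \<in> W"
  shows "l h \<le> D u h"
proof -
  define t :: "nat \<Rightarrow> real" where "t n = inverse (real (Suc n))" for n
  have t: "0 < t n" "t n \<le> 1" for n
    by (auto simp: t_def field_simps)
  have t_lim: "t \<longlonglongrightarrow> 0"
    unfolding t_def by (rule LIMSEQ_inverse_real_of_nat)
  define U where "U n = (\<lambda>v. u v + t n * h v)" for n
  have U: "U n \<in> W" for n
    unfolding U_def by (rule W_add_scaled[OF u h])
  have LU: "L (U n) i = L u i + t n * L h i" for n i
    unfolding U_def by (rule L_linear)
  have D_U: "l h \<le> D (U n) h" for n
  proof -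
    have "L (\<lambda>v. u v - U n v) i = - t n * L h i" for i
      by (simp add: L_diff LU)
    then have "D (U n) (\<lambda>v. u v - U n v) = (\<Sum>\<^sub>\<infinity>i. - t n * (a i * (\<bar>L (U n) i\<bar> powr (p - 2) * L (U n) i) * L h i))"
      unfolding D_def by (intro infsum_cong) simp
    also have "\<dots> = - t n * D (U n) h"
      unfolding D_def by (rule infsum_cmult_right')
    finally have "E (U n) / p - t n * D (U n) h \<le> E u / p"
      using E_tangent_le[OF U u, of n] by simp
    moreover have "l (U n) = l u + t n * l h"
      unfolding U_def by (rule l_add_scaled[OF u h])
    ultimately have "t n * l h \<le> t n * D (U n) h"
      using min[OF U, of n] by (simp add: F_def)
    then show ?thesis using t(1)[of n] by simp
  qed
  \<comment> \<open>The majorant combines \<open>abs_powr_deriv_mult_le\<close> with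
    \<open>abs_add_powr_le\<close>, using \<open>t n \<le> 1\<close>; the extra 1 in the second
    coefficient is the summand \<open>\<bar>L h i\<bar> powr p\<close> of the former.\<close>
  define G where "G i = 2 powr p * (a i * \<bar>L u i\<bar> powr p) + (2 powr p + 1) * (a i * \<bar>L h i\<bar> powr p)" for i
  have G: "G summable_on UNIV"
    unfolding G_def by (intro summable_on_add summable_on_cmult_right E_summable u h)
  define d where "d n = (\<lambda>i. a i * (\<bar>L (U n) i\<bar> powr (p - 2) * L (U n) i) * L h i)" for n
  have d_summable: "d n summable_on UNIV" for n
    unfolding d_def by (rule D_summable[OF U h])
  have d_le: "d n i \<le> G i" for n i
  proof -
    have "\<bar>t n * L h i\<bar> powr p \<le> \<bar>L h i\<bar> powr p"
      by (rule powr_mono2) (use p t[of n] in \<open>auto simp: abs_mult mult_left_le_one_le\<close>)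
    then have "2 powr p * (\<bar>L u i\<bar> powr p + \<bar>t n * L h i\<bar> powr p) \<le> 2 powr p * (\<bar>L u i\<bar> powr p + \<bar>L h i\<bar> powr p)"
      by simp
    then have "\<bar>L (U n) i\<bar> powr p \<le> 2 powr p * (\<bar>L u i\<bar> powr p + \<bar>L h i\<bar> powr p)"
      using abs_add_powr_le[of p "L u i" "t n * L h i"] p unfolding LU by linarith
    moreover have "\<bar>L (U n) i\<bar> powr (p - 2) * L (U n) i * L h i \<le> \<bar>L (U n) i\<bar> powr p + \<bar>L h i\<bar> powr p"
      using abs_powr_deriv_mult_le[OF p, of "L (U n) i" "L h i"] by linarith
    ultimately have "\<bar>L (U n) i\<bar> powr (p - 2) * L (U n) i * L h i
        \<le> 2 powr p * (\<bar>L u i\<bar> powr p + \<bar>L h i\<bar> powr p) + \<bar>L h i\<bar> powr p"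
      by linarith
    from mult_left_mono[OF this a_nonneg[of i]] show ?thesis
      by (simp add: d_def G_def algebra_simps)
  qed
  have diff: "(\<Sum>\<^sub>\<infinity>i. G i - f i) = infsum G UNIV - infsum f UNIV" if "f summable_on UNIV" for f
    using infsum_add[OF G summable_on_uminus[THEN iffD2, OF that]] by (simp add: infsum_uminus)
  have "(\<Sum>\<^sub>\<infinity>i. G i - a i * (\<bar>L u i\<bar> powr (p - 2) * L u i) * L h i) \<le> infsum G UNIV - l h"
  proof (rule infsum_Fatou(2)[where f = "\<lambda>n i. G i - d n i" and B = "\<lambda>n. infsum G UNIV - l h"])
    show "(\<lambda>i. G i - d n i) summable_on UNIV" for n
      using summable_on_add[OF G summable_on_uminus[THEN iffD2, OF d_summable]] by simp
    show "(\<Sum>\<^sub>\<infinity>i. G i - d n i) \<le> infsum G UNIV - l h" for n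
      unfolding diff[OF d_summable] using D_U[of n] by (simp add: D_def d_def)
    fix i
    have "(\<lambda>n. L u i + t n * L h i) \<longlonglongrightarrow> L u i + 0 * L h i"
      by (intro tendsto_intros t_lim)
    then have "(\<lambda>n. L (U n) i) \<longlonglongrightarrow> L u i"
      by (simp add: LU)
    then show "(\<lambda>n. G i - d n i) \<longlonglongrightarrow> G i - a i * (\<bar>L u i\<bar> powr (p - 2) * L u i) * L h i"
      unfolding d_def by (intro tendsto_intros tendsto_abs_powr_deriv p)
  qed (auto simp: d_le)
  then show ?thesis
    unfolding diff[OF D_summable[OF u h]] by (simp add: D_def)
qed

text \<open>The one-sided inequality holds for \<open>h\<close> and for \<open>- h\<close>, which
  forces equality.\<close>

lemma minimal_imp_critical:
  assumes u: "u \<in> W" and min: "\<And>g. g \<in> W \<Longrightarrow> F u \<le> F g"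
  shows "critical u"
  unfolding critical_def
proof (intro conjI ballI u)
  fix h assume h: "h \<in> W"
  have "l (\<lambda>v. - h v) = - l h"
    by (simp add: l_def infsum_uminus)
  moreover have "(\<lambda>v. - h v) \<in> W"
    using W_diff[OF zero_in_W h] by simp
  ultimately show "D u h = l h"
    using minimal_imp_D_ge[OF u min h] minimal_imp_D_ge[OF u min, of "\<lambda>v. - h v"] by (simp add: D_minus)
qed

end

section \<open>Uniqueness and existence under a Poincare inequality\<close>

locale coercive_torsion_problem = torsion_problem +
  fixes M :: real
  assumes M: "M > 0"
    and poincare: "u \<in> W \<Longrightarrow> N u powr (1 / q) \<le> M * E u powr (1 / p)"
begin

lemma poincare_powr:
  assumes "u \<in> W"
  shows "N u \<le> M powr q * E u powr (q / p)"
proof -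
  have "(N u powr (1 / q)) powr q \<le> (M * E u powr (1 / p)) powr q"
    by (rule powr_mono2) (use q poincare[OF assms] in auto)
  then show ?thesis
    using q M N_nonneg[of u] by (simp add: powr_powr powr_mult)
qed

text \<open>Subtracting the two equations, tested with the difference \<open>g\<close>, makes a sum
  of nonnegative monotonicity terms vanish. Hence \<open>L g\<close> is zero wherever the weight is
  not, so \<open>E g = 0\<close>; the Poincare inequality gives \<open>N g = 0\<close>, and
  \<open>m > 0\<close> gives \<open>g = 0\<close>.\<close>

lemma critical_unique:
  assumes u: "critical u" and h: "critical h"
  shows "u = h"
proof -
  have uW: "u \<in> W" and hW: "h \<in> W" using u h by (auto simp: critical_def)
  define g where "g = (\<lambda>v. u v - h v)"
  have g: "g \<in> W" unfolding g_def by (rule W_diff[OF uW hW])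
  have Lg: "L g i = L u i - L h i" for i unfolding g_def by (rule L_diff)
  define f where "f i = a i * ((\<bar>L u i\<bar> powr (p - 2) * L u i - \<bar>L h i\<bar> powr (p - 2) * L h i) * (L u i - L h i))" for i
  have eq: "f i = a i * (\<bar>L u i\<bar> powr (p - 2) * L u i) * L g i + - (a i * (\<bar>L h i\<bar> powr (p - 2) * L h i) * L g i)" for i
    unfolding f_def Lg by (simp add: algebra_simps)
  note s = D_summable[OF uW g] summable_on_uminus[THEN iffD2, OF D_summable[OF hW g]]
  have "infsum f UNIV = D u g - D h g"
    unfolding eq infsum_add[OF s] infsum_uminus D_def by simp
  then have f0: "infsum f UNIV \<le> 0"
    using u h g by (simp add: critical_def)
  have fs: "f summable_on UNIV"
    unfolding eq by (rule summable_on_add[OF s])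
  have "f i = 0" for i
  proof (rule nonneg_infsum_le_0D[OF f0 fs])
    show "0 \<le> f j" for j
      unfolding f_def by (intro mult_nonneg_nonneg a_nonneg abs_powr_deriv_monotone(1) p)
  qed simp
  then have "a i = 0 \<or> L g i = 0" for i
    using abs_powr_deriv_monotone(2)[OF p, of "L u i" "L h i"] unfolding f_def Lg
    by (metis mult_eq_0_iff right_minus_eq)
  then have "a i * \<bar>L g i\<bar> powr p = 0" for i by auto
  then have "E g = 0"
    unfolding E_def by (simp only: infsum_0)
  then have "N g \<le> 0"
    using poincare_powr[OF g] p by simp
  then have "\<bar>g v\<bar> powr q * m v = 0" for v
    unfolding N_def by (rule nonneg_infsum_le_0D[OF _ N_summable[OF g]]) (auto simp: m_pos less_imp_le)
  then have "g v = 0" for v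
    using m_pos[of v] by (metis abs_eq_0 less_numeral_extra(3) mult_eq_0_iff powr_eq_0_iff)
  then show ?thesis
    by (auto simp: g_def)
qed

lemma l_le:
  obtains C where "C > 0" "\<And>u. u \<in> W \<Longrightarrow> l u \<le> C * (E u + 1) powr (1 / p)"
proof
  have m0: "infsum m UNIV \<ge> 0"
    by (intro infsum_nonneg) (simp add: m_pos less_imp_le)
  show "infsum m UNIV + M powr q > 0"
    using M m0 by (simp add: add_nonneg_pos)
  fix u assume u: "u \<in> W"
  \<comment> \<open>At this level the Poincare bound makes both truncation terms multiples of
    \<open>R\<close>. The added 1 keeps \<open>R\<close> positive when
    \<open>E u = 0\<close>.\<close>
  define R where "R = (E u + 1) powr (1 / p)"
  have R: "R > 0" using E_nonneg[of u] by (simp add: R_def)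
  have "l u \<le> (\<Sum>\<^sub>\<infinity>v. (R + R powr (1 - q) * \<bar>u v\<bar> powr q) * m v)"
    unfolding l_def
  proof (rule infsum_mono[OF l_summable[OF u] truncation_summable(1)[OF u]])
    fix v
    have "u v \<le> R + R powr (1 - q) * \<bar>u v\<bar> powr q"
      using abs_le_truncation[of q R "u v"] q R by simp
    then show "u v * m v \<le> (R + R powr (1 - q) * \<bar>u v\<bar> powr q) * m v"
      using m_pos[of v] by simp
  qed
  also have "\<dots> = R * infsum m UNIV + R powr (1 - q) * N u"
    by (rule truncation_summable(2)[OF u])
  also have "N u \<le> M powr q * R powr q"
  proof -
    have "E u powr (q / p) \<le> (E u + 1) powr (q / p)"
      by (rule powr_mono2) (use E_nonneg[of u] p q in auto)
    also have "\<dots> = R powr q"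
      by (simp add: R_def powr_powr)
    finally show ?thesis
      using poincare_powr[OF u] M by (meson mult_left_mono order_trans powr_ge_zero)
  qed
  then have "R * infsum m UNIV + R powr (1 - q) * N u \<le> R * infsum m UNIV + R powr (1 - q) * (M powr q * R powr q)"
    by (simp add: mult_left_mono)
  also have "\<dots> = (infsum m UNIV + M powr q) * R"
  proof -
    have "R powr (1 - q) * R powr q = R"
      using R by (simp flip: powr_add)
    then show ?thesis by (simp add: algebra_simps)
  qed
  finally show "l u \<le> (infsum m UNIV + M powr q) * (E u + 1) powr (1 / p)"
    by (simp add: R_def)
qed

text \<open>Since \<open>1 / p < 1\<close>, the linear part grows more slowly than the energy, so
  half of \<open>E u / p\<close> absorbs it up to a constant.\<close>

lemma coercive:
  obtains K where "\<And>u. u \<in> W \<Longrightarrow> E u / (2 * p) - K \<le> F u"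
proof -
  obtain C where C: "C > 0" "\<And>u. u \<in> W \<Longrightarrow> l u \<le> C * (E u + 1) powr (1 / p)"
    using l_le by blast
  \<comment> \<open>Solves \<open>C * R powr (1 - p) = 1 / (2 * p)\<close>, so that truncation with
    exponent \<open>p\<close> in place of \<open>q\<close> costs exactly half of the energy
    term.\<close>
  define R where "R = (2 * p * C) powr (1 / (p - 1))"
  have R: "R > 0" using C p by (simp add: R_def)
  have "1 / (p - 1) * (1 - p) = - 1"
    using p by (simp add: field_simps)
  then have "R powr (1 - p) = (2 * p * C) powr (- 1)"
    unfolding R_def powr_powr by (simp only:)
  then have RC: "C * R powr (1 - p) = 1 / (2 * p)"
    using C p by (simp add: powr_minus_divide)
  have "E u / (2 * p) - (C * R + 1 / (2 * p)) \<le> F u" if u: "u \<in> W" for u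
  proof -
    define s where "s = (E u + 1) powr (1 / p)"
    have s: "s \<ge> 0" "s powr p = E u + 1"
      using E_nonneg[of u] p by (auto simp: s_def powr_powr)
    have "C * s \<le> C * (R + R powr (1 - p) * s powr p)"
      using abs_le_truncation[of p R s] s R p C by simp
    also have "\<dots> = C * R + (C * R powr (1 - p)) * (E u + 1)"
      by (simp add: s algebra_simps)
    finally have "l u \<le> C * R + (E u + 1) / (2 * p)"
      using C(2)[OF u] unfolding RC s_def by simp
    moreover have "E u / p = E u / (2 * p) + E u / (2 * p)"
      using p by (simp add: field_simps)
    ultimately show ?thesis
      by (simp add: F_def add_divide_distrib)
  qed
  then show ?thesis using that by blast
qed

lemma minimizer_exists:
  obtains u where "u \<in> W" "\<And>g. g \<in> W \<Longrightarrow> F u \<le> F g"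
proof -
  obtain K where K: "\<And>u. u \<in> W \<Longrightarrow> E u / (2 * p) - K \<le> F u"
    using coercive by blast
  define I where "I = Inf (F ` W)"
  have bdd: "bdd_below (F ` W)"
  proof (rule bdd_belowI2)
    show "- K \<le> F u" if "u \<in> W" for u
      using K[OF that] E_nonneg[of u] p by (smt (verit) divide_nonneg_pos)
  qed
  have I_le: "I \<le> F u" if "u \<in> W" for u
    unfolding I_def by (rule cINF_lower[OF bdd that])
  have "\<exists>u\<in>W. F u < I + inverse (real (Suc n))" for n
    using cInf_lessD[of "F ` W" "I + inverse (real (Suc n))"] zero_in_W
    by (force simp: I_def)
  then obtain X where X: "\<And>n. X n \<in> W" and XI: "\<And>n. F (X n) < I + inverse (real (Suc n))"
    by metis
  have F_lim: "(\<lambda>n. F (X n)) \<longlonglongrightarrow> I"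
  proof (rule tendsto_sandwich[OF _ _ tendsto_const])
    show "(\<lambda>n. I + inverse (real (Suc n))) \<longlonglongrightarrow> I"
      using tendsto_add[OF tendsto_const LIMSEQ_inverse_real_of_nat, of I] by simp
  qed (use I_le[OF X] less_imp_le[OF XI] in simp_all)
  \<comment> \<open>Coercivity along the minimizing sequence, whose values satisfy
    \<open>F (X n) \<le> I + 1\<close>.\<close>
  define B where "B = 2 * p * (I + 1 + K)"
  have EB: "E (X n) \<le> B" for n
  proof -
    have "inverse (real (Suc n)) \<le> 1" by (simp add: field_simps)
    then have "E (X n) / (2 * p) \<le> I + 1 + K"
      using K[OF X, of n] XI[of n] by linarith
    then show ?thesis using p by (simp add: B_def field_simps)
  qed
  define A where "A = M powr q * B powr (q / p)"
  have NA: "N (X n) \<le> A" for n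
  proof -
    have "E (X n) powr (q / p) \<le> B powr (q / p)"
      by (rule powr_mono2) (use EB E_nonneg p q in auto)
    then show ?thesis
      using poincare_powr[OF X, of n] M unfolding A_def by (meson mult_left_mono order_trans powr_ge_zero)
  qed
  \<comment> \<open>A single term of \<open>N (X n) \<le> A\<close> bounds
    \<open>\<bar>X n v\<bar> powr q\<close> by \<open>A / m v\<close>, and truncation at level 1
    bounds \<open>\<bar>X n v\<bar>\<close> by \<open>w v\<close>. Dividing by \<open>w v\<close>
    makes the bound uniform over the vertices.\<close>
  define w where "w v = 1 + A / m v" for v
  have A0: "A \<ge> 0" by (simp add: A_def)
  have w: "w v > 0" for v using A0 m_pos[of v] by (simp add: w_def add_pos_nonneg)
  have Xw: "\<bar>X n v\<bar> \<le> w v" for n v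
  proof -
    have "\<bar>X n v\<bar> powr q * m v \<le> N (X n)"
      using finite_sum_le_infsum[OF N_summable[OF X], of "{v}" n] m_pos unfolding N_def by (simp add: less_imp_le)
    then have "\<bar>X n v\<bar> powr q \<le> A / m v"
      using NA[of n] m_pos[of v] by (simp add: field_simps)
    then show ?thesis
      using abs_le_truncation[of q 1 "X n v"] q by (simp add: w_def)
  qed
  \<comment> \<open>Besides the normalised values at the vertices, the index \<open>None\<close> makes the energies converge.\<close>
  define f where "f n x = (case x of None \<Rightarrow> E (X n) | Some v \<Rightarrow> X n v / w v)" for n x
  have f_bound: "norm (f n x) \<le> max B 1" for n x
  proof (cases x)
    case None
    then show ?thesis using EB[of n] E_nonneg[of "X n"] by (simp add: f_def)
  next
    case (Some v)
    then show ?thesis using Xw[of n v] w[of v] by (simp add: f_def le_max_iff_disj field_simps)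
  qed
  \<comment> \<open>Uniformly bounded functions on a countable set have a pointwise convergent
    subsequence, by a diagonal argument.\<close>
  obtain k :: "nat \<Rightarrow> nat" where k: "strict_mono k" and conv: "\<And>x. \<exists>z. (\<lambda>n. f (k n) x) \<longlonglongrightarrow> z"
    using function_convergent_subsequence[of "UNIV :: 'a option set" f "max B 1"] f_bound
    by (metis countableI_type UNIV_I)
  define Y where "Y n = X (k n)" for n
  note Y = X[of "k _", folded Y_def]
  obtain e where e: "(\<lambda>n. E (Y n)) \<longlonglongrightarrow> e"
    using conv[of None] by (auto simp: f_def Y_def)
  have "\<exists>z. (\<lambda>n. Y n v) \<longlonglongrightarrow> z" for v
  proof -
    obtain z where "(\<lambda>n. Y n v / w v) \<longlonglongrightarrow> z"
      using conv[of "Some v"] by (auto simp: f_def Y_def)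
    then have "(\<lambda>n. w v * (Y n v / w v)) \<longlonglongrightarrow> w v * z"
      by (rule tendsto_mult_left)
    then show ?thesis using w[of v] by auto
  qed
  then obtain u where u: "\<And>v. (\<lambda>n. Y n v) \<longlonglongrightarrow> u v"
    by metis
  have F_lim': "(\<lambda>n. F (Y n)) \<longlonglongrightarrow> I"
    using LIMSEQ_subseq_LIMSEQ[OF F_lim k] by (simp add: o_def Y_def)
  \<comment> \<open>The limit of the linear part is read off from those of \<open>E\<close> and
    \<open>F\<close>; whether it equals \<open>l u\<close> is not yet known.\<close>
  have l_lim: "(\<lambda>n. l (Y n)) \<longlonglongrightarrow> e / p - I"
    using tendsto_diff[OF tendsto_divide[OF e tendsto_const[of p]] F_lim'] p by (simp add: F_def)
  have powr_lim: "(\<lambda>n. \<bar>g n\<bar> powr r) \<longlonglongrightarrow> \<bar>x\<bar> powr r" if "g \<longlonglongrightarrow> x" "r > 1" for g x and r :: real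
    by (rule tendsto_powr2) (use that in \<open>auto intro!: tendsto_intros\<close>)
  have lim_E: "(\<lambda>n. a i * \<bar>L (Y n) i\<bar> powr p) \<longlonglongrightarrow> a i * \<bar>L u i\<bar> powr p" for i
    by (intro tendsto_mult_left powr_lim L_tendsto u p)
  have lim_N: "(\<lambda>n. \<bar>Y n v\<bar> powr q * m v) \<longlonglongrightarrow> \<bar>u v\<bar> powr q * m v" for v
    by (intro tendsto_mult_right powr_lim u q)
  \<comment> \<open>Fatou for the energies yields lower semicontinuity and finite energy of
    \<open>u\<close>; for the norms the constant bound \<open>A\<close> suffices to place
    \<open>u\<close> in the q-summable functions.\<close>
  note fatou_E = infsum_Fatou[OF _ E_summable[OF Y] eq_refl[OF E_def[symmetric]] e lim_E]
  note fatou_N = infsum_Fatou[OF _ N_summable[OF Y] NA[of "k _", folded Y_def, unfolded N_def] tendsto_const lim_N]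
  have Eu: "E u \<le> e"
    unfolding E_def by (rule fatou_E(2)) (simp add: a_nonneg)
  have "u v = 0" if "v \<in> V0" for v
    using LIMSEQ_unique[OF u[of v]] Y that by (simp add: W_def)
  then have uW: "u \<in> W"
    unfolding W_def using fatou_E(1) fatou_N(1) by (simp add: a_nonneg m_pos less_imp_le)
  have trunc: "(\<lambda>v. (R + R powr (1 - q) * \<bar>g v\<bar> powr q) * m v - g v * m v) summable_on UNIV"
    "(\<Sum>\<^sub>\<infinity>v. (R + R powr (1 - q) * \<bar>g v\<bar> powr q) * m v - g v * m v)
      = R * infsum m UNIV + R powr (1 - q) * N g - l g" if "g \<in> W" for g R
    using summable_on_add[OF truncation_summable(1)[OF that] summable_on_uminus[THEN iffD2, OF l_summable[OF that]]]
      infsum_add[OF truncation_summable(1)[OF that] summable_on_uminus[THEN iffD2, OF l_summable[OF that]]]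
    by (simp_all add: truncation_summable(2)[OF that] infsum_uminus l_def)
  \<comment> \<open>No mass is lost in the limit: subtracting \<open>Y n v\<close> from its
    truncation bound leaves nonnegative terms, so Fatou applies. The terms
    \<open>R * infsum m UNIV\<close> cancel, leaving an error of order
    \<open>R powr (1 - q)\<close>.\<close>
  have l_ge: "e / p - I - l u \<le> R powr (1 - q) * A" if R: "R > 0" for R
  proof -
    have "(\<Sum>\<^sub>\<infinity>v. (R + R powr (1 - q) * \<bar>u v\<bar> powr q) * m v - u v * m v)
        \<le> R * infsum m UNIV + R powr (1 - q) * A - (e / p - I)"
    proof (rule infsum_Fatou(2)[OF _ trunc(1)[OF Y]])
      show "0 \<le> (R + R powr (1 - q) * \<bar>Y n v\<bar> powr q) * m v - Y n v * m v" for n v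
      proof -
        have "Y n v \<le> R + R powr (1 - q) * \<bar>Y n v\<bar> powr q"
          using abs_le_truncation[of q R "Y n v"] q R by simp
        then show ?thesis using m_pos[of v] by simp
      qed
      show "(\<Sum>\<^sub>\<infinity>v. (R + R powr (1 - q) * \<bar>Y n v\<bar> powr q) * m v - Y n v * m v)
        \<le> R * infsum m UNIV + R powr (1 - q) * A - l (Y n)" for n
        unfolding trunc(2)[OF Y] using NA[of "k n", folded Y_def] by (simp add: mult_left_mono)
      show "(\<lambda>n. R * infsum m UNIV + R powr (1 - q) * A - l (Y n))
          \<longlonglongrightarrow> R * infsum m UNIV + R powr (1 - q) * A - (e / p - I)"
        by (intro tendsto_intros l_lim)
      show "(\<lambda>n. (R + R powr (1 - q) * \<bar>Y n v\<bar> powr q) * m v - Y n v * m v)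
        \<longlonglongrightarrow> (R + R powr (1 - q) * \<bar>u v\<bar> powr q) * m v - u v * m v" for v
        by (intro tendsto_diff tendsto_mult_right tendsto_mult_left tendsto_add tendsto_const powr_lim u q)
    qed
    moreover have "R powr (1 - q) * N u \<ge> 0"
      by (simp add: N_nonneg)
    ultimately show ?thesis
      unfolding trunc(2)[OF uW] by linarith
  qed
  \<comment> \<open>As \<open>q > 1\<close>, the error vanishes when \<open>R\<close> tends to
    infinity.\<close>
  have "e / p - I - l u \<le> 0"
  proof (rule tendsto_lowerbound)
    have "((\<lambda>R. R powr (1 - q)) \<longlongrightarrow> 0) at_top"
      by (rule tendsto_neg_powr) (use q in \<open>auto simp: filterlim_ident\<close>)
    then show "((\<lambda>R. R powr (1 - q) * A) \<longlongrightarrow> 0) at_top"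
      by (rule tendsto_mult_left_zero)
    show "\<forall>\<^sub>F R in at_top. e / p - I - l u \<le> R powr (1 - q) * A"
      using eventually_gt_at_top[of 0] by eventually_elim (rule l_ge)
  qed simp
  \<comment> \<open>With \<open>E u \<le> e\<close> and \<open>l u \<ge> e / p - I\<close>, the
    quantity \<open>e\<close> cancels.\<close>
  then have "F u \<le> I"
    using Eu p divide_right_mono[OF Eu, of p] by (simp add: F_def)
  then show ?thesis
    using that[OF uW] I_le by force
qed

lemma minimizer_iff_critical: "u \<in> W \<and> (\<forall>g\<in>W. F u \<le> F g) \<longleftrightarrow> critical u"
proof
  show "critical u" if "u \<in> W \<and> (\<forall>g\<in>W. F u \<le> F g)"
    using that by (intro minimal_imp_critical) auto
  show "u \<in> W \<and> (\<forall>g\<in>W. F u \<le> F g)" if "critical u"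
    using that critical_imp_minimal by (simp add: critical_def)
qed

lemma critical_ex1: "\<exists>!u. critical u"
proof -
  obtain u where "u \<in> W" "\<And>g. g \<in> W \<Longrightarrow> F u \<le> F g"
    using minimizer_exists by blast
  then have "critical u"
    by (rule minimal_imp_critical)
  then show ?thesis
    using critical_unique by auto
qed

end

section \<open>Translation between the abstract problem and the graph\<close>

text \<open>Edges \<open>Inl (v, w)\<close> and vertices \<open>Inr v\<close> serve as one index set, so that both parts of the
  energy become a single weighted \<open>p\<close>-norm.\<close>
definition graph_weight :: "('v \<Rightarrow> 'v \<Rightarrow> real) \<Rightarrow> ('v \<Rightarrow> real) \<Rightarrow> ('v \<times> 'v) + 'v \<Rightarrow> real" where
  "graph_weight b c = case_sum (\<lambda>(v, w). b v w / 2) c"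

definition graph_diff :: "('v \<Rightarrow> real) \<Rightarrow> ('v \<times> 'v) + 'v \<Rightarrow> real" where
  "graph_diff u = case_sum (\<lambda>(v, w). u v - u w) u"

text \<open>Lets the problem without boundary conditions be treated as the Dirichlet problem with
  empty boundary.\<close>

lemma w_space_eq_w0_space: "w_space p q m b c = w0_space p q m b c {}"
  by (simp add: w0_space_def)

lemma torsion_problem_graph:
  assumes "1 < p" "1 < q" "weighted_graph m b c" "m summable_on UNIV"
  shows "torsion_problem p q m (graph_weight b c) graph_diff"
proof -
  interpret weighted_graph m b c by fact
  show ?thesis
  proof
    show "0 \<le> graph_weight b c i" for i
      by (auto simp: graph_weight_def b_nonneg c_nonneg split: sum.split)
    show "graph_diff (\<lambda>v. u v + t * h v) i = graph_diff u i + t * graph_diff h i" for u t h i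
      by (auto simp: graph_diff_def algebra_simps split: sum.split)
    show "(\<lambda>n. graph_diff (U n) i) \<longlonglongrightarrow> graph_diff u i" if "\<And>v. (\<lambda>n. U n v) \<longlonglongrightarrow> u v" for U u i
      by (auto simp: graph_diff_def split: sum.split intro!: tendsto_diff that)
  qed (use assms m_pos in auto)
qed

context
  fixes p q :: real and m :: "'v::countable \<Rightarrow> real" and b :: "'v \<Rightarrow> 'v \<Rightarrow> real" and c :: "'v \<Rightarrow> real"
  assumes p: "1 < p" and q: "1 < q" and graph: "weighted_graph m b c" and m_summable: "m summable_on UNIV"
begin

interpretation weighted_graph m b c by (rule graph)

interpretation T: torsion_problem p q m "graph_weight b c" graph_diff V0 for V0
  by (rule torsion_problem_graph[OF p q graph m_summable])

lemma energy_finite_iff: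
  "energy p b c u < \<infinity> \<longleftrightarrow> (\<lambda>i. graph_weight b c i * \<bar>graph_diff u i\<bar> powr p) summable_on UNIV"
proof -
  have "(\<lambda>(v, w). b v w / 2 * \<bar>u v - u w\<bar> powr p) summable_on UNIV \<longleftrightarrow>
      (\<lambda>(v, w). b v w * \<bar>u v - u w\<bar> powr p) summable_on UNIV"
    using summable_on_cmult_left'[of 2 "\<lambda>(v, w). b v w / 2 * \<bar>u v - u w\<bar> powr p" UNIV]
    by (simp add: case_prod_unfold mult.commute)
  moreover have "(\<Sum>\<^sub>\<infinity>(v, w)\<in>UNIV. ennreal (b v w * \<bar>u v - u w\<bar> powr p)) < \<infinity> \<longleftrightarrow>
      (\<lambda>(v, w). b v w * \<bar>u v - u w\<bar> powr p) summable_on UNIV"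
    using infsum_ennreal_of_nonneg(2)[of "\<lambda>(v, w). b v w * \<bar>u v - u w\<bar> powr p"]
    by (simp add: case_prod_unfold b_nonneg)
  moreover have "(\<Sum>\<^sub>\<infinity>v. ennreal (c v * \<bar>u v\<bar> powr p)) < \<infinity> \<longleftrightarrow>
      (\<lambda>v. c v * \<bar>u v\<bar> powr p) summable_on UNIV"
    by (rule infsum_ennreal_of_nonneg(2)) (simp add: c_nonneg)
  moreover have "ennreal r * x < \<infinity> \<longleftrightarrow> x < \<infinity>" if "r > 0" for r x
    using that by (auto simp: ennreal_mult_less_top)
  ultimately show ?thesis
    using p unfolding energy_def summable_on_sum_type
    by (simp add: graph_weight_def graph_diff_def case_prod_unfold)
qed

text \<open>The edge weight \<open>b v w / 2\<close> absorbs the factor for counting ordered pairs,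
  so \<open>1 / p\<close> remains as common prefactor. Membership in \<open>T.W V0\<close> makes
  both sums finite, hence \<open>enn2real\<close> loses nothing.\<close>

lemma energy_eq_E:
  assumes "u \<in> T.W V0"
  shows "enn2real (energy p b c u) = T.E u / p"
proof -
  note s = T.E_summable[OF assms]
  define f where "f = (\<lambda>(v, w). b v w / 2 * \<bar>u v - u w\<bar> powr p)"
  define g where "g v = c v * \<bar>u v\<bar> powr p" for v
  have sf: "f summable_on UNIV" and sg: "g summable_on UNIV"
    using s unfolding summable_on_sum_type
    by (simp_all add: f_def g_def[abs_def] graph_weight_def graph_diff_def case_prod_unfold)
  have E: "T.E u = infsum f UNIV + infsum g UNIV"
    unfolding T.E_def infsum_sum_type[OF s]
    by (simp add: f_def g_def[abs_def] graph_weight_def graph_diff_def case_prod_unfold)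
  have f0: "infsum f UNIV \<ge> 0" and g0: "infsum g UNIV \<ge> 0"
    by (auto intro!: infsum_nonneg simp: f_def g_def b_nonneg c_nonneg)
  have "(\<Sum>\<^sub>\<infinity>(v, w)\<in>UNIV. ennreal (b v w * \<bar>u v - u w\<bar> powr p)) = (\<Sum>\<^sub>\<infinity>x. ennreal (2 * f x))"
    by (simp add: f_def case_prod_unfold)
  also have "\<dots> = ennreal (2 * infsum f UNIV)"
    unfolding infsum_cmult_right'[symmetric]
    using sf by (intro infsum_ennreal_of_nonneg(1) summable_on_cmult_right) (auto simp: f_def b_nonneg)
  finally have "energy p b c u = ennreal (1 / (2 * p)) * ennreal (2 * infsum f UNIV) + ennreal (1 / p) * ennreal (infsum g UNIV)"
    using infsum_ennreal_of_nonneg(1)[of g] sg by (simp add: energy_def g_def c_nonneg)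
  also have "\<dots> = ennreal (1 / (2 * p) * (2 * infsum f UNIV) + 1 / p * infsum g UNIV)"
    using f0 g0 p by (subst ennreal_plus) (simp_all flip: ennreal_mult')
  also have "1 / (2 * p) * (2 * infsum f UNIV) + 1 / p * infsum g UNIV = T.E u / p"
    using p by (simp add: E field_simps)
  finally show ?thesis
    using T.E_nonneg p by simp
qed

lemma w0_space_eq_W: "w0_space p q m b c V0 = T.W V0"
  unfolding w0_space_def w_space_def lq_space_def T.W_def energy_finite_iff by auto

lemma energy_deriv_eq_D:
  assumes "u \<in> T.W V0" "h \<in> T.W V0"
  shows "energy_deriv p b c u h = T.D u h"
proof -
  note s = T.D_summable[OF assms]
  have "T.D u h = (\<Sum>\<^sub>\<infinity>(v, w)\<in>UNIV. 1 / 2 * (b v w * (\<bar>u v - u w\<bar> powr (p - 2) * (u v - u w)) * (h v - h w)))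
      + (\<Sum>\<^sub>\<infinity>v. c v * (\<bar>u v\<bar> powr (p - 2) * u v) * h v)"
    unfolding T.D_def infsum_sum_type[OF s]
    by (simp add: graph_weight_def graph_diff_def case_prod_unfold)
  then show ?thesis
    unfolding energy_deriv_def case_prod_unfold infsum_cmult_right' by simp
qed

lemma torsion_functional_eq_F: "u \<in> T.W V0 \<Longrightarrow> torsion_functional p m b c u = T.F u"
  by (simp add: torsion_functional_def T.F_def T.l_def energy_eq_E)

text \<open>Members of \<open>T.W V0\<close> are summable against \<open>m\<close> by
  \<open>abs_summable_W\<close>, so both sides test against the same functions.\<close>

lemma torsion_function_iff_critical:
  "torsion_function p m b c (w0_space p q m b c V0) u \<longleftrightarrow> T.critical V0 u"
proof -
  have "T.W V0 \<inter> lq_space 1 m = T.W V0"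
    using T.abs_summable_W by (auto simp: lq_space_def powr_one)
  then show ?thesis
    unfolding torsion_function_def w0_space_eq_W T.critical_def T.l_def
    using energy_deriv_eq_D by auto
qed

lemma torsion_Dirichlet:
  assumes M: "M > 0"
    and poincare: "\<And>u. u \<in> w0_space p q m b c V0 \<Longrightarrow>
        lq_norm q (UNIV - V0) m u \<le> M * enn2real (energy p b c u) powr (1 / p)"
  shows "\<exists>!u. torsion_function p m b c (w0_space p q m b c V0) u"
    and "torsion_function p m b c (w0_space p q m b c V0) u \<Longrightarrow>
        is_arg_min (torsion_functional p m b c) (\<lambda>v. v \<in> w0_space p q m b c V0) g \<longleftrightarrow> g = u"
proof -
  \<comment> \<open>The energy is \<open>T.E u / p\<close>, so the Poincare constant picks up the
    factor \<open>(1 / p) powr (1 / p)\<close>.\<close>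
  interpret C: coercive_torsion_problem p q m "graph_weight b c" graph_diff V0 "M * (1 / p) powr (1 / p)"
  proof
    show "0 < M * (1 / p) powr (1 / p)"
      using M p by simp
    fix u assume u: "u \<in> T.W V0"
    \<comment> \<open>Vertices in \<open>V0\<close> contribute nothing because \<open>u\<close>
      vanishes there and \<open>0 powr q = 0\<close>.\<close>
    have "(\<Sum>\<^sub>\<infinity>v\<in>UNIV - V0. \<bar>u v\<bar> powr q * m v) = T.N u"
      unfolding T.N_def by (rule infsum_cong_neutral) (use u in \<open>auto simp: T.W_def\<close>)
    then have "lq_norm q (UNIV - V0) m u = T.N u powr (1 / q)"
      by (simp add: lq_norm_def)
    moreover have "enn2real (energy p b c u) = 1 / p * T.E u"
      using energy_eq_E[OF u] by simp
    ultimately show "T.N u powr (1 / q) \<le> M * (1 / p) powr (1 / p) * T.E u powr (1 / p)"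
      using poincare[of u] u by (simp add: w0_space_eq_W powr_mult powr_divide)
  qed
  show "\<exists>!u. torsion_function p m b c (w0_space p q m b c V0) u"
    unfolding torsion_function_iff_critical by (rule C.critical_ex1)
  assume "torsion_function p m b c (w0_space p q m b c V0) u"
  then have u: "T.critical V0 u"
    by (simp only: torsion_function_iff_critical)
  have "is_arg_min (torsion_functional p m b c) (\<lambda>v. v \<in> w0_space p q m b c V0) g \<longleftrightarrow>
      g \<in> T.W V0 \<and> (\<forall>h\<in>T.W V0. T.F g \<le> T.F h)"
    unfolding is_arg_min_def w0_space_eq_W by (auto simp: torsion_functional_eq_F not_less)
  also have "\<dots> \<longleftrightarrow> g = u"
    using C.minimizer_iff_critical C.critical_unique u by blast
  finally show "is_arg_min (torsion_functional p m b c) (\<lambda>v. v \<in> w0_space p q m b c V0) g \<longleftrightarrow> g = u" .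
qed

end

theorem theorem3p7:
  fixes p q :: real
    and m :: "'v::countable \<Rightarrow> real"
    and b :: "'v \<Rightarrow> 'v \<Rightarrow> real"
    and c :: "'v \<Rightarrow> real"
  assumes "1 < p" and "1 < q"
    and "weighted_graph m b c"
    and "m summable_on UNIV"
  shows
    "((SUP v. ennreal (c v)) > 0 \<and>
     (\<exists>M>0. \<forall>u \<in> w_space p q m b c.
        lq_norm q UNIV m u \<le> M * enn2real (energy p b c u) powr (1 / p)) \<longrightarrow>
     uniquely_torsional_admissible q p m b c \<and>
     (\<forall>u. torsion_function p m b c (w_space p q m b c) u \<longrightarrow>
        (\<forall>v. is_arg_min (torsion_functional p m b c) (\<lambda>v. v \<in> w_space p q m b c) v \<longleftrightarrow> v = u))) \<and>
     (\<forall>V0. V0 \<noteq> {} \<and>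
     (\<exists>M>0. \<forall>u \<in> w0_space p q m b c V0.
        lq_norm q (UNIV - V0) m u \<le> M * enn2real (energy p b c u) powr (1 / p)) \<longrightarrow>
     uniquely_torsional_admissible_Dirichlet q p m b c V0 \<and>
     (\<forall>u. torsion_function p m b c (w0_space p q m b c V0) u \<longrightarrow>
        (\<forall>v. is_arg_min (torsion_functional p m b c) (\<lambda>v. v \<in> w0_space p q m b c V0) v \<longleftrightarrow> v = u)))"
proof -
  \<comment> \<open>With \<open>V0\<close> arbitrary, the empty set serves the first half of the
    claim and nonempty sets the second.\<close>
  have *: "(\<exists>!u. torsion_function p m b c (w0_space p q m b c V0) u) \<and>
     (\<forall>u. torsion_function p m b c (w0_space p q m b c V0) u \<longrightarrow>
        (\<forall>v. is_arg_min (torsion_functional p m b c) (\<lambda>v. v \<in> w0_space p q m b c V0) v \<longleftrightarrow> v = u))"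
    if "\<exists>M>0. \<forall>u \<in> w0_space p q m b c V0.
        lq_norm q (UNIV - V0) m u \<le> M * enn2real (energy p b c u) powr (1 / p)" for V0
  proof -
    from that obtain M where M: "M > 0" "\<And>u. u \<in> w0_space p q m b c V0 \<Longrightarrow>
        lq_norm q (UNIV - V0) m u \<le> M * enn2real (energy p b c u) powr (1 / p)"
      by blast
    show ?thesis
      using torsion_Dirichlet[OF assms M] by simp
  qed
  show ?thesis
    unfolding uniquely_torsional_admissible_def uniquely_torsional_admissible_Dirichlet_def
      w_space_eq_w0_space
    by (intro conjI impI allI; elim conjE) (use *[of "{}", unfolded Diff_empty] * in simp_all)
qed

end
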